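(* For any $m,A\in\mathbb N^+$, there exists a POMDP with $A$ actions and with $S,H,O=\mathcal O(m)$, satisfying the $m$-step $\alpha$-weakly revealing condition with $\alpha\ge1$, so that any algorithm requires at least $\Omega(A^{m-1})$ samples to learn a $(1/2)$-optimal policy with probability at least $1/2$.
   Context: Notation: $[n]=\{1,\dots,n\}$; $\Delta_X$ is the set of probability distributions on a finite set $X$; $\sigma_j(M)$ is the $j$-th largest singular value of $M$; $\mathcal O(\cdot)$ and $\Omega(\cdot)$ hide absolute constants. POMDP: a tuple $(\mathscr S,\mathscr A,\mathscr O;H,\mu_1,\mathbb T,\mathbb O;r)$ with finite sets of states, actions, observations of sizes $S,A,O$; horizon $H$; initial state distribution $\mu_1$; transition matrices $\mathbb T_{h,a}\in\mathbb R^{S\times S}$, where $\mathbb T_{h,a}(\cdot\mid s)$ is the distribution of the next state; emission matrices $\mathbb O_h\in\mathbb R^{O\times S}$, where $\mathbb O_h(\cdot\mid s)$ is the distribution of the observation; rewards $r_h:\mathscr O\to[0,1]$. In an episode $s_1\sim\mu_1$; at step $h$ the learner sees $o_h\sim\mathbb O_h(\cdot\mid s_h)$, receives $r_h(o_h)$, takes $a_h$, and $s_{h+1}\sim\mathbb T_{h,a_h}(\cdot\mid s_h)$; the episode ends after step $H$. States are never observed. A policy is $\pi=\{\pi_h\}_{h=1}^H$ with $\pi_h:(\mathscr O\times\mathscr A)^{h-1}\times\mathscr O\to\Delta_{\mathscr A}$; $V^\pi=\mathbb E_\pi[\sum_{h=1}^H r_h(o_h)]$, $V^\star=\sup_\pi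 V^\pi$; $\pi$ is $\epsilon$-optimal if $V^\pi\ge V^\star-\epsilon$. $m$-step emission-action matrices: $\mathbb M_h\in\mathbb R^{(A^{m-1}O^m)\times S}$, $h\in[H-m+1]$, with $[\mathbb M_h]_{(\mathbf a,\mathbf o),s}=\mathbb P(o_{h:h+m-1}=\mathbf o\mid s_h=s,\ a_{h:h+m-2}=\mathbf a)$ for $\mathbf a\in\mathscr A^{m-1}$, $\mathbf o\in\mathscr O^m$, $s\in\mathscr S$. The $m$-step $\alpha$-weakly revealing condition is $\min_{h\in[H-m+1]}\sigma_S(\mathbb M_h)\ge\alpha$. An algorithm interacts with the unknown POMDP for some number of episodes (samples), choosing in each episode a policy based on past data and observing only the observations, its actions and rewards, and finally outputs a policy.
   Formalization: "There exists a POMDP" is read as a family of POMDPs with common S, H, O, on all of which the algorithm must succeed (for one fixed POMDP, outputting its optimal policy needs no samples); for A=1 the bound is claimed only for algorithms using at least one sample, as zero suffice there. *)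

theory Defs
  imports "HOL-Probability.Probability" "Jordan_Normal_Form.Char_Poly"
begin

section \<open>Singular values\<close>

text \<open>
  The singular values of a real matrix \<open>X\<close>: square roots of the eigenvalues of \<open>X\<^sup>T X\<close>, with
  multiplicity and in decreasing order. As \<open>X\<^sup>T X\<close> is real symmetric, its characteristic
  polynomial splits over the reals, so the list has length \<open>dim_col X\<close>; for a wide matrix the
  entries beyond \<open>dim_row X\<close> are 0.
\<close>

definition singular_values :: "real mat \<Rightarrow> real list" where
  "singular_values X =
     map sqrt (rev (sorted_list_of_multiset (proots (char_poly (transpose_mat X * X)))))"

text \<open>The index is one-based, and meaningful for \<open>1 \<le> j \<le> dim_col X\<close>.\<close>

definition singular_value :: "nat \<Rightarrow> real mat \<Rightarrow> real" where
  "singular_value j X = singular_values X ! (j - 1)"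


section \<open>Partially observable Markov decision processes\<close>

text \<open>
  States, actions and observations are the numbers below \<open>num_states\<close>, \<open>num_actions\<close> and
  \<open>num_obs\<close>. Steps are counted from 1 to \<open>horizon\<close>. The argument order is
  \<open>trans P h a s\<close>, \<open>emit P h s\<close> and \<open>reward P h o\<close>.
\<close>

record pomdp =
  num_states :: nat
  num_actions :: nat
  num_obs :: nat
  horizon :: nat
  init :: "nat pmf"
  trans :: "nat \<Rightarrow> nat \<Rightarrow> nat \<Rightarrow> nat pmf"
  emit :: "nat \<Rightarrow> nat \<Rightarrow> nat pmf"
  reward :: "nat \<Rightarrow> nat \<Rightarrow> real"

definition valid_pomdp :: "pomdp \<Rightarrow> bool" where
  "valid_pomdp P \<longleftrightarrow>
     set_pmf (init P) \<subseteq> {..<num_states P} \<and>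
     (\<forall>h\<in>{1..horizon P}. \<forall>a<num_actions P. \<forall>s<num_states P.
        set_pmf (trans P h a s) \<subseteq> {..<num_states P}) \<and>
     (\<forall>h\<in>{1..horizon P}. \<forall>s<num_states P. set_pmf (emit P h s) \<subseteq> {..<num_obs P}) \<and>
     (\<forall>h\<in>{1..horizon P}. \<forall>ob<num_obs P. 0 \<le> reward P h ob \<and> reward P h ob \<le> 1)"


subsection \<open>Policies and values\<close>

type_synonym history = "(nat \<times> nat) list"

text \<open>
  \<open>\<pi> h \<tau> ob\<close> is the distribution of the action at step \<open>h\<close>, given the preceding
  observation-action pairs \<open>\<tau>\<close> (earliest first) and the current observation \<open>ob\<close>.
\<close>

type_synonym policy = "nat \<Rightarrow> history \<Rightarrow> nat \<Rightarrow> nat pmf"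

definition histories :: "nat \<Rightarrow> nat \<Rightarrow> nat \<Rightarrow> history set" where
  "histories nA nO n = {\<tau>. length \<tau> = n \<and> set \<tau> \<subseteq> {..<nO} \<times> {..<nA}}"

definition policies :: "nat \<Rightarrow> nat \<Rightarrow> nat \<Rightarrow> policy set" where
  "policies nA nO H =
     {\<pi>. \<forall>h\<in>{1..H}. \<forall>\<tau>\<in>histories nA nO (h - 1). \<forall>ob<nO. set_pmf (\<pi> h \<tau> ob) \<subseteq> {..<nA}}"

text \<open>
  Continue for \<open>n\<close> further steps from the current state \<open>s\<close> after the history \<open>\<tau>\<close>.
\<close>

primrec rollout :: "pomdp \<Rightarrow> policy \<Rightarrow> nat \<Rightarrow> history \<Rightarrow> nat \<Rightarrow> history pmf" where
  "rollout P \<pi> 0 \<tau> s = return_pmf \<tau>"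
| "rollout P \<pi> (Suc n) \<tau> s =
     (let h = length \<tau> + 1 in
      bind_pmf (emit P h s) (\<lambda>ob.
      bind_pmf (\<pi> h \<tau> ob) (\<lambda>a.
      bind_pmf (trans P h a s) (\<lambda>s'.
      rollout P \<pi> n (\<tau> @ [(ob, a)]) s'))))"

definition episode :: "pomdp \<Rightarrow> policy \<Rightarrow> history pmf" where
  "episode P \<pi> = bind_pmf (init P) (\<lambda>s. rollout P \<pi> (horizon P) [] s)"

definition policy_value :: "pomdp \<Rightarrow> policy \<Rightarrow> real" where
  "policy_value P \<pi> =
     measure_pmf.expectation (episode P \<pi>) (\<lambda>\<tau>. \<Sum>h = 1..horizon P. reward P h (fst (\<tau> ! (h - 1))))"

definition optimal_value :: "pomdp \<Rightarrow> real" where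
  "optimal_value P = (SUP \<pi> \<in> policies (num_actions P) (num_obs P) (horizon P). policy_value P \<pi>)"

definition eps_optimal :: "pomdp \<Rightarrow> real \<Rightarrow> policy \<Rightarrow> bool" where
  "eps_optimal P \<epsilon> \<pi> \<longleftrightarrow> policy_value P \<pi> \<ge> optimal_value P - \<epsilon>"


subsection \<open>The weakly revealing condition\<close>

text \<open>
  The joint distribution of the observations at steps \<open>h, \<dots>, h + length as\<close>, starting in state
  \<open>s\<close> at step \<open>h\<close> and executing the fixed action sequence \<open>as\<close>.
\<close>

primrec obs_seq :: "pomdp \<Rightarrow> nat list \<Rightarrow> nat \<Rightarrow> nat \<Rightarrow> nat list pmf" where
  "obs_seq P [] h s = map_pmf (\<lambda>ob. [ob]) (emit P h s)"
| "obs_seq P (a # as) h s =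
     bind_pmf (emit P h s) (\<lambda>ob.
     bind_pmf (trans P h a s) (\<lambda>s'.
     map_pmf (\<lambda>obs. ob # obs) (obs_seq P as (h + 1) s')))"

text \<open>
  The rows of an emission-action matrix are indexed by pairs of an action sequence and an
  observation sequence; the list below fixes an (immaterial) enumeration of these pairs.
\<close>

definition row_indices :: "pomdp \<Rightarrow> nat \<Rightarrow> (nat list \<times> nat list) list" where
  "row_indices P m =
     List.product (List.n_lists (m - 1) [0..<num_actions P]) (List.n_lists m [0..<num_obs P])"

definition emission_action_mat :: "pomdp \<Rightarrow> nat \<Rightarrow> nat \<Rightarrow> real mat" where
  "emission_action_mat P m h =
     mat (length (row_indices P m)) (num_states P)
       (\<lambda>(i, s). let (as, obs) = row_indices P m ! i in pmf (obs_seq P as h s) obs)"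

text \<open>The condition \<open>m \<le> horizon P\<close> makes the range of the minimum nonempty.\<close>

definition weakly_revealing :: "nat \<Rightarrow> real \<Rightarrow> pomdp \<Rightarrow> bool" where
  "weakly_revealing m \<alpha> P \<longleftrightarrow>
     1 \<le> m \<and> m \<le> horizon P \<and>
     (MIN h \<in> {1..horizon P - m + 1}.
        singular_value (num_states P) (emission_action_mat P m h)) \<ge> \<alpha>"


section \<open>Learning algorithms\<close>

text \<open>
  In every episode the learner records the observations, its actions and the rewards received.
\<close>

type_synonym data = "(nat \<times> nat \<times> real) list list"

definition recorded :: "pomdp \<Rightarrow> history \<Rightarrow> (nat \<times> nat \<times> real) list" where
  "recorded P \<tau> =
     map (\<lambda>i. (fst (\<tau> ! i), snd (\<tau> ! i), reward P (i + 1) (fst (\<tau> ! i)))) [0..<length \<tau>]"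

text \<open>
  The internal randomness of a randomised algorithm is a seed drawn once at the beginning,
  independently of the environment. As the seed is available to all later choices, this covers
  fresh randomisation in every episode and the memory of earlier random choices.
\<close>

record algorithm =
  seed :: "real measure"
  num_episodes :: nat
  explore :: "real \<Rightarrow> data \<Rightarrow> policy"
  final :: "real \<Rightarrow> data \<Rightarrow> policy"

definition measurable_choice ::
    "nat \<Rightarrow> nat \<Rightarrow> nat \<Rightarrow> real measure \<Rightarrow> (real \<Rightarrow> data \<Rightarrow> policy) \<Rightarrow> bool" where
  "measurable_choice nA nO H M f \<longleftrightarrow>
     (\<forall>\<omega>\<in>space M. \<forall>D. f \<omega> D \<in> policies nA nO H) \<and>
     (\<forall>D. \<forall>h\<in>{1..H}. \<forall>\<tau>\<in>histories nA nO (h - 1). \<forall>ob<nO. \<forall>a<nA.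
        (\<lambda>\<omega>. pmf (f \<omega> D h \<tau> ob) a) \<in> borel_measurable M)"

definition valid_algorithm :: "nat \<Rightarrow> nat \<Rightarrow> nat \<Rightarrow> algorithm \<Rightarrow> bool" where
  "valid_algorithm nA nO H alg \<longleftrightarrow>
     prob_space (seed alg) \<and>
     measurable_choice nA nO H (seed alg) (explore alg) \<and>
     measurable_choice nA nO H (seed alg) (final alg)"

primrec interact :: "pomdp \<Rightarrow> (data \<Rightarrow> policy) \<Rightarrow> nat \<Rightarrow> data pmf" where
  "interact P f 0 = return_pmf []"
| "interact P f (Suc k) =
     bind_pmf (interact P f k) (\<lambda>D. map_pmf (\<lambda>\<tau>. D @ [recorded P \<tau>]) (episode P (f D)))"

text \<open>The probability that the final policy is \<open>\<epsilon>\<close>-optimal, over the seed and all episodes.\<close>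

definition success_prob :: "pomdp \<Rightarrow> real \<Rightarrow> algorithm \<Rightarrow> real" where
  "success_prob P \<epsilon> alg =
     (\<integral>\<omega>. measure_pmf.prob (interact P (explore alg \<omega>) (num_episodes alg))
            {D. eps_optimal P \<epsilon> (final alg \<omega> D)} \<partial>seed alg)"

end

theory Submission
  imports Defs
begin

text \<open>
  The hard instances are combination locks with \<open>m + 1\<close> action digits and two states: open so
  far, and failed for good. The state is visible at step 1 and after step \<open>m\<close> only. In any
  window of \<open>m\<close> steps, playing the correct digits preserves both states until one of these
  visible steps, which gives two rows of the emission-action matrix equal to the unit vectors.

  A policy is \<open>1/2\<close>-optimal only if it opens the lock with probability at least \<open>3/4\<close>, so it
  is \<open>1/2\<close>-optimal for at most one password. An episode that does not start with the first
  \<open>m\<close> digits has the same likelihood under the lock and under a null instance that nothing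
  opens. Each episode hits these digits for at most \<open>A\<close> passwords; hence, summing the success
  probabilities over all passwords and comparing with the null instance, \<open>T\<close> episodes satisfy
  \<open>A\<^sup>m\<^sup>+\<^sup>1 / 2 \<le> 1 + T * A\<close>. The digit \<open>m + 1\<close> matters only for \<open>m = 1\<close> and
  \<open>A = 2\<close>, where two passwords could be served by a random guess.
\<close>

section \<open>Matrices with two columns\<close>

lemma det_2x2:
  assumes "B \<in> carrier_mat 2 2"
  shows "Determinant.det B = B $$ (0,0) * B $$ (1,1) - B $$ (1,0) * B $$ (0,1)"
proof -
  have del: "mat_delete B i 0 \<in> carrier_mat 1 1" for i
    using mat_delete_carrier[OF assms, of i 0] by simp
  have "Determinant.det B = (\<Sum>i<2. B $$ (i,0) * cofactor B i 0)"
    by (rule laplace_expansion_column[OF assms]) simp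
  also have "\<dots> = B $$ (0,0) * cofactor B 0 0 + B $$ (1,0) * cofactor B 1 0"
    by (simp add: numeral_2_eq_2)
  also have "cofactor B 0 0 = B $$ (1,1)"
    using assms det_single[OF del[of 0]] by (simp add: cofactor_def mat_delete_def)
  also have "cofactor B 1 0 = - B $$ (0,1)"
    using assms det_single[OF del[of 1]] by (simp add: cofactor_def mat_delete_def)
  finally show ?thesis by simp
qed

lemma char_poly_2x2:
  assumes "B \<in> carrier_mat 2 2"
  shows "char_poly B =
    [:B $$ (0,0) * B $$ (1,1) - B $$ (1,0) * B $$ (0,1), - (B $$ (0,0) + B $$ (1,1)), 1:]"
proof -
  have "char_poly_matrix B \<in> carrier_mat 2 2" using assms by simp
  then show ?thesis
    unfolding char_poly_def using assms
    by (subst det_2x2) (auto simp: char_poly_matrix_def)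
qed

text \<open>The two unit rows contribute the identity to \<open>transpose_mat X * X\<close> and the
  other rows a positive semidefinite Gram matrix, so every eigenvalue is at least 1. With two
  columns the eigenvalues are explicit.\<close>

lemma smallest_singular_value_ge_1:
  fixes X :: "real mat"
  assumes X: "X \<in> carrier_mat n 2"
    and i: "i < n" "X $$ (i,0) = 1" "X $$ (i,1) = 0"
    and j: "j < n" "X $$ (j,0) = 0" "X $$ (j,1) = 1"
  shows "singular_value 2 X \<ge> 1"
proof -
  define B where "B = transpose_mat X * X"
  define a d b where "a = (\<Sum>k<n. (X $$ (k,0))\<^sup>2)" and "d = (\<Sum>k<n. (X $$ (k,1))\<^sup>2)"
    and "b = (\<Sum>k<n. X $$ (k,0) * X $$ (k,1))"
  define R where "R = {..<n} - {i, j}"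
  have B: "B \<in> carrier_mat 2 2" using X by (simp add: B_def)
  have entries: "B $$ (0,0) = a" "B $$ (1,1) = d" "B $$ (0,1) = b" "B $$ (1,0) = b"
    using X by (auto simp: B_def a_def b_def d_def scalar_prod_def power2_eq_square atLeast0LessThan
        mult.commute)
  have "i \<noteq> j" using i j by auto
  have split: "(\<Sum>k<n. f k) = f i + f j + sum f R" for f :: "nat \<Rightarrow> real"
  proof -
    have "{..<n} = insert i (insert j R)" using i j by (auto simp: R_def)
    then have "sum f {..<n} = sum f (insert i (insert j R))" by (rule arg_cong)
    also have "\<dots> = f i + f j + sum f R" using \<open>i \<noteq> j\<close> by (simp add: R_def)
    finally show ?thesis .
  qed
  have a: "a = 1 + (\<Sum>k\<in>R. (X $$ (k,0))\<^sup>2)" and d: "d = 1 + (\<Sum>k\<in>R. (X $$ (k,1))\<^sup>2)"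
    and b: "b = (\<Sum>k\<in>R. X $$ (k,0) * X $$ (k,1))"
    using i j by (simp_all add: a_def d_def b_def split)
  \<comment> \<open>The rows in \<open>R\<close> have a Gram matrix with diagonal
    \<open>a - 1\<close>, \<open>d - 1\<close> and off-diagonal \<open>b\<close>; its determinant is
    nonnegative.\<close>
  have cs: "b\<^sup>2 \<le> (a - 1) * (d - 1)"
    unfolding a b d by (simp add: Cauchy_Schwarz_ineq_sum)
  have a1: "a \<ge> 1" and d1: "d \<ge> 1" unfolding a d by (simp_all add: sum_nonneg)

  \<comment> \<open>The discriminant of the characteristic polynomial, written as a sum of squares:
    it is nonnegative, so the roots \<open>p\<close> and \<open>q\<close> are real.\<close>
  define D where "D = sqrt ((a - d)\<^sup>2 + 4 * b\<^sup>2)"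
  define p q where "p = (a + d - D) / 2" and "q = (a + d + D) / 2"
  have D2: "D * D = (a - d)\<^sup>2 + 4 * b\<^sup>2" by (simp add: D_def)
  have sum: "p + q = a + d" by (simp add: p_def q_def field_simps)
  have "4 * (p * q) = (a + d - D) * (a + d + D)"
    by (simp add: p_def q_def)
  also have "\<dots> = (a + d)\<^sup>2 - D * D"
    by (simp add: power2_eq_square algebra_simps)
  finally have prod: "p * q = a * d - b * b"
    unfolding D2 by (simp add: power2_eq_square algebra_simps)
  have "char_poly B = [:-p, 1:] * [:-q, 1:]"
    by (simp add: char_poly_2x2[OF B] entries[simplified] sum[symmetric] prod[symmetric] mult.commute)
  then have roots: "proots (char_poly B) = {#p, q#}"
    by (simp add: proots_mult del: mult_pCons_left mult_pCons_right)
  \<comment> \<open>For \<open>r\<close> below 1 the factors exceed \<open>a - 1\<close> and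
    \<open>d - 1\<close>, so their product would exceed \<open>b\<^sup>2\<close> by
    \<open>cs\<close>.\<close>
  have ge1: "r \<ge> 1" if "(a - r) * (d - r) = b\<^sup>2" for r
  proof (rule ccontr)
    assume "\<not> r \<ge> 1"
    then have "(a - 1) * (d - 1) < (a - r) * (d - r)"
      using a1 d1 by (intro mult_strict_mono') auto
    with that cs show False by simp
  qed
  have "(a - r) * (d - r) = a * d - (p + q) * r + r * r" for r
    unfolding sum by (simp add: algebra_simps)
  from this[of p] this[of q] have "(a - p) * (d - p) = b\<^sup>2" "(a - q) * (d - q) = b\<^sup>2"
    using prod by (simp_all add: power2_eq_square algebra_simps)
  then have *: "p \<ge> 1" "q \<ge> 1" using ge1 by blast+
  define xs where "xs = rev (sorted_list_of_multiset (proots (char_poly B)))"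
  have "mset xs = {#p, q#}" by (simp add: xs_def roots)
  then have "length xs = 2" "set xs = {p, q}"
    by (simp_all flip: size_mset set_mset_mset)
  \<comment> \<open>Which of the two roots is smaller need not be decided.\<close>
  then have "xs ! 1 \<in> {p, q}" using nth_mem[of 1 xs] by simp
  with * \<open>length xs = 2\<close> show ?thesis
    by (auto simp: singular_value_def singular_values_def xs_def B_def)
qed

section \<open>Combination locks\<close>

text \<open>
  State 1 means that the lock can still be opened, and state 0 is absorbing. Two steps carry a
  reward: with a single one, a policy that opens the lock only half of the time would already
  be \<open>1/2\<close>-optimal.
\<close>

definition lock :: "nat \<Rightarrow> nat \<Rightarrow> (nat \<Rightarrow> nat \<Rightarrow> bool) \<Rightarrow> pomdp" where
  "lock A m ok = \<lparr>num_states = 2, num_actions = A, num_obs = 2, horizon = m + 3,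
     init = return_pmf 1,
     trans = (\<lambda>h a s. return_pmf (if ok h a then s else 0)),
     emit = (\<lambda>h s. return_pmf (if h = 1 \<or> m < h then s else 0)),
     reward = (\<lambda>h ob. of_bool (m + 1 < h \<and> ob = 1))\<rparr>"

text \<open>After the last digit every action is accepted, so an opened lock stays open through both
  rewarded steps.\<close>

definition password :: "nat list \<Rightarrow> nat \<Rightarrow> nat \<Rightarrow> bool" where
  "password w h a \<longleftrightarrow> length w < h \<or> a = w ! (h - 1)"

lemma lock_simps [simp]:
  "num_states (lock A m ok) = 2" "num_actions (lock A m ok) = A" "num_obs (lock A m ok) = 2"
  "horizon (lock A m ok) = m + 3" "init (lock A m ok) = return_pmf 1"
  "trans (lock A m ok) h a s = return_pmf (if ok h a then s else 0)"
  "emit (lock A m ok) h s = return_pmf (if h = 1 \<or> m < h then s else 0)"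
  "reward (lock A m ok) h ob = of_bool (m + 1 < h \<and> ob = 1)"
  by (simp_all add: lock_def)

lemma valid_lock: "valid_pomdp (lock A m ok)"
  by (auto simp: valid_pomdp_def)

lemma obs_seq_lock:
  assumes "\<forall>i<length as. ok (h + i) (as ! i)"
  shows "obs_seq (lock A m ok) as h s =
    return_pmf (map (\<lambda>i. if h + i = 1 \<or> m < h + i then s else 0) [0..<Suc (length as)])"
  using assms
proof (induction as arbitrary: h)
  case Nil
  then show ?case by simp
next
  case (Cons a as)
  have "ok h a" and *: "\<forall>i<length as. ok (Suc h + i) (as ! i)"
    using Cons.prems by (force dest: spec[of _ 0], force dest: spec[of _ "Suc i" for i])
  have "[0..<Suc (length (a # as))] = 0 # map Suc [0..<Suc (length as)]"
    by (simp only: map_Suc_upt length_Cons) (rule upt_conv_Cons, simp)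
  then show ?case
    using Cons.IH[OF *] \<open>ok h a\<close> by (simp add: bind_return_pmf comp_def del: upt_Suc)
qed

lemma weakly_revealing_lock:
  assumes "1 \<le> m" and ok: "\<And>h. \<exists>a<A. ok h a"
  shows "weakly_revealing m 1 (lock A m ok)"
proof -
  let ?P = "lock A m ok"
  \<comment> \<open>The horizon \<open>m + 3\<close> leaves four starting steps for a window of
    length \<open>m\<close>.\<close>
  have "singular_value (num_states ?P) (emission_action_mat ?P m h) \<ge> 1" if h: "h \<in> {1..4}" for h
  proof -
    obtain g where g: "\<And>h. g h < A" "\<And>h. ok h (g h)" using ok by metis
    define as where "as = map (\<lambda>i. g (h + i)) [0..<m - 1]"
    define obs where
      "obs s = map (\<lambda>i. if h + i = 1 \<or> m < h + i then s else 0) [0..<m]" for s :: nat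
    have seq: "obs_seq ?P as h s = return_pmf (obs s)" for s
      using obs_seq_lock[of as ok h A m s] g \<open>1 \<le> m\<close> by (simp add: as_def obs_def)
    \<comment> \<open>A window from step 1 shows the state at once; a later one ends at step
      \<open>h + m - 1\<close>, which is beyond \<open>m\<close>.\<close>
    have "obs 0 ! (if h = 1 then 0 else m - 1) \<noteq> obs 1 ! (if h = 1 then 0 else m - 1)"
      using h \<open>1 \<le> m\<close> by (auto simp: obs_def)
    then have neq: "obs 0 \<noteq> obs 1" by metis
    have "(as, obs s) \<in> set (row_indices ?P m)" if "s < 2" for s
      using that g by (auto simp: row_indices_def set_n_lists as_def obs_def)
    then obtain i j where i: "i < length (row_indices ?P m)" "row_indices ?P m ! i = (as, obs 0)"
      and j: "j < length (row_indices ?P m)" "row_indices ?P m ! j = (as, obs 1)"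
      by (metis in_set_conv_nth zero_less_numeral one_less_numeral_iff semiring_norm(76))
    \<comment> \<open>The observations are deterministic and differ between the states, so row
      \<open>(as, obs s)\<close> is the unit vector of state \<open>s\<close>.\<close>
    show ?thesis
      unfolding lock_simps
      by (rule smallest_singular_value_ge_1[of _ "length (row_indices ?P m)" i j])
        (use i j neq in \<open>auto simp: emission_action_mat_def seq\<close>)
  qed
  then show ?thesis
    using \<open>1 \<le> m\<close> by (auto simp: weakly_revealing_def intro!: Min.boundedI)
qed

section \<open>Trajectories\<close>

text \<open>Transitions are deterministic, so the hidden state is a function of the actions
  played.\<close>

definition lock_state :: "(nat \<Rightarrow> nat \<Rightarrow> bool) \<Rightarrow> history \<Rightarrow> nat" where
  "lock_state ok \<tau> = of_bool (\<forall>i<length \<tau>. ok (Suc i) (snd (\<tau> ! i)))"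

text \<open>This is the observation at step \<open>length \<tau> + 1\<close>, whence
  \<open>m < h\<close> turns into \<open>m \<le> length \<tau>\<close>.\<close>

definition lock_obs :: "nat \<Rightarrow> (nat \<Rightarrow> nat \<Rightarrow> bool) \<Rightarrow> history \<Rightarrow> nat" where
  "lock_obs m ok \<tau> = (if \<tau> = [] \<or> m \<le> length \<tau> then lock_state ok \<tau> else 0)"

lemma lock_state_Nil [simp]: "lock_state ok [] = 1"
  by (simp add: lock_state_def)

lemma lock_state_snoc:
  "lock_state ok (\<tau> @ [x]) = (if ok (Suc (length \<tau>)) (snd x) then lock_state ok \<tau> else 0)"
  by (auto simp: lock_state_def nth_append less_Suc_eq)

text \<open>Once the state is tied to the history, the action is the only random draw left in a
  step.\<close>

lemma rollout_lock_Suc: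
  "rollout (lock A m ok) \<pi> (Suc n) \<tau> (lock_state ok \<tau>) =
    bind_pmf (\<pi> (Suc (length \<tau>)) \<tau> (lock_obs m ok \<tau>)) (\<lambda>a.
      rollout (lock A m ok) \<pi> n (\<tau> @ [(lock_obs m ok \<tau>, a)])
        (lock_state ok (\<tau> @ [(lock_obs m ok \<tau>, a)])))"
  by (auto simp: Let_def bind_return_pmf lock_obs_def lock_state_snoc less_Suc_eq_le
      intro!: bind_pmf_cong)

lemma episode_lock: "episode (lock A m ok) \<pi> = rollout (lock A m ok) \<pi> (m + 3) [] (lock_state ok [])"
  by (simp add: episode_def bind_return_pmf)

lemma set_pmf_rollout_lock:
  assumes "\<sigma> \<in> set_pmf (rollout (lock A m ok) \<pi> n \<tau> (lock_state ok \<tau>))"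
  shows "length \<sigma> = length \<tau> + n \<and> take (length \<tau>) \<sigma> = \<tau> \<and>
    (\<forall>i. length \<tau> \<le> i \<longrightarrow> i < length \<sigma> \<longrightarrow> fst (\<sigma> ! i) = lock_obs m ok (take i \<sigma>) \<and>
      snd (\<sigma> ! i) \<in> set_pmf (\<pi> (Suc i) (take i \<sigma>) (fst (\<sigma> ! i))))"
  using assms
proof (induction n arbitrary: \<tau>)
  case 0
  then show ?case by simp
next
  case (Suc n)
  let ?ob = "lock_obs m ok \<tau>"
  obtain a where a: "a \<in> set_pmf (\<pi> (Suc (length \<tau>)) \<tau> ?ob)"
    and "\<sigma> \<in> set_pmf (rollout (lock A m ok) \<pi> n (\<tau> @ [(?ob, a)]) (lock_state ok (\<tau> @ [(?ob, a)])))"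
    using Suc.prems unfolding rollout_lock_Suc by auto
  note * = Suc.IH[OF this(2)]
  then have len: "length \<sigma> = Suc (length \<tau> + n)"
    and take: "take (Suc (length \<tau>)) \<sigma> = \<tau> @ [(?ob, a)]" by auto
  then have "take (length \<tau>) \<sigma> = \<tau>" "\<sigma> ! length \<tau> = (?ob, a)"
    by (auto simp: take_Suc_conv_app_nth)
  moreover have "fst (\<sigma> ! i) = lock_obs m ok (take i \<sigma>) \<and>
      snd (\<sigma> ! i) \<in> set_pmf (\<pi> (Suc i) (take i \<sigma>) (fst (\<sigma> ! i)))"
    if "length \<tau> \<le> i" "i < length \<sigma>" for i
  proof (cases "i = length \<tau>")
    case True
    then show ?thesis using calculation a by simp
  next
    case False
    then have "length (\<tau> @ [(?ob, a)]) \<le> i" using that by simp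
    then show ?thesis using * that by blast
  qed
  ultimately show ?case unfolding len add_Suc_right by blast
qed

lemma set_pmf_episode_lock:
  assumes "\<sigma> \<in> set_pmf (episode (lock A m ok) \<pi>)"
  shows "length \<sigma> = m + 3"
    and "i < m + 3 \<Longrightarrow> fst (\<sigma> ! i) = lock_obs m ok (take i \<sigma>)"
    and "i < m + 3 \<Longrightarrow> snd (\<sigma> ! i) \<in> set_pmf (\<pi> (Suc i) (take i \<sigma>) (fst (\<sigma> ! i)))"
proof -
  note * = set_pmf_rollout_lock[OF assms[unfolded episode_lock]]
  show len: "length \<sigma> = m + 3" using * by simp
  show "fst (\<sigma> ! i) = lock_obs m ok (take i \<sigma>)" if "i < m + 3" using * that len by simp
  show "snd (\<sigma> ! i) \<in> set_pmf (\<pi> (Suc i) (take i \<sigma>) (fst (\<sigma> ! i)))" if "i < m + 3"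
    using *[THEN conjunct2, THEN conjunct2, rule_format, of i, THEN conjunct2] that len by simp
qed

text \<open>The likelihood of a trajectory is a product of action probabilities, and the policy
  feels the lock only through the observations.\<close>

lemma pmf_rollout_lock_cong:
  assumes "\<forall>i<length \<sigma>. lock_obs m ok (take i \<sigma>) = lock_obs m ok' (take i \<sigma>)"
  shows "pmf (rollout (lock A m ok) \<pi> n \<tau> (lock_state ok \<tau>)) \<sigma> =
    pmf (rollout (lock A m ok') \<pi> n \<tau> (lock_state ok' \<tau>)) \<sigma>"
proof (induction n arbitrary: \<tau>)
  case 0
  then show ?case by simp
next
  case (Suc n)
  show ?case
  \<comment> \<open>Only proper prefixes of \<open>\<sigma>\<close> matter: from any other history
    both likelihoods are 0.\<close>
  proof (cases "take (length \<tau>) \<sigma> = \<tau> \<and> length \<tau> < length \<sigma>")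
    case True
    then have "lock_obs m ok \<tau> = lock_obs m ok' \<tau>" using assms by metis
    then show ?thesis
      unfolding rollout_lock_Suc by (simp add: pmf_bind Suc.IH del: rollout.simps)
  next
    case False
    then have "pmf (rollout (lock A m ok'') \<pi> (Suc n) \<tau> (lock_state ok'' \<tau>)) \<sigma> = 0" for ok''
      using set_pmf_rollout_lock[of \<sigma> A m ok'' \<pi> "Suc n" \<tau>]
      by (auto simp: pmf_eq_0_set_pmf simp del: rollout.simps)
    then show ?thesis by simp
  qed
qed

lemma pmf_episode_lock_cong:
  assumes "\<forall>i<length \<sigma>. lock_obs m ok (take i \<sigma>) = lock_obs m ok' (take i \<sigma>)"
  shows "pmf (episode (lock A m ok) \<pi>) \<sigma> = pmf (episode (lock A m ok') \<pi>) \<sigma>"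
  unfolding episode_lock by (rule pmf_rollout_lock_cong[OF assms])

lemma measure_pmf_cong_on:
  assumes "\<And>x. x \<in> X \<Longrightarrow> pmf p x = pmf q x"
  shows "measure_pmf.prob p X = measure_pmf.prob q X"
proof -
  have "emeasure (measure_pmf p) X = emeasure (measure_pmf q) X"
    unfolding nn_integral_pmf[symmetric] by (intro nn_integral_cong) (simp add: assms)
  then show ?thesis by (simp add: measure_def)
qed


section \<open>Values of policies\<close>

lemma lock_state_password:
  assumes "length w \<le> length \<tau>"
  shows "lock_state (password w) \<tau> = of_bool (take (length w) (map snd \<tau>) = w)"
proof -
  have "password w (Suc i) a \<longleftrightarrow> (i < length w \<longrightarrow> a = w ! i)" for i a
    by (auto simp: password_def)
  then have "(\<forall>i<length \<tau>. password w (Suc i) (snd (\<tau> ! i))) \<longleftrightarrow> (\<forall>i<length w. snd (\<tau> ! i) = w ! i)"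
    using assms by auto
  also have "\<dots> \<longleftrightarrow> take (length w) (map snd \<tau>) = w"
    using assms by (auto simp: list_eq_iff_nth_eq)
  finally show ?thesis by (simp add: lock_state_def)
qed

text \<open>
  As long as the password is being entered, the observations are those of the lock that
  accepts everything, whatever the password is.
\<close>

lemma policy_value_lock:
  assumes w: "length w = m + 1"
  shows "policy_value (lock A m (password w)) \<pi> =
    2 * measure_pmf.prob (episode (lock A m (\<lambda>_ _. True)) \<pi>) {\<tau>. take (m + 1) (map snd \<tau>) = w}"
proof -
  let ?P = "lock A m (password w)" and ?X = "{\<tau> :: history. take (m + 1) (map snd \<tau>) = w}"
  have sum: "(\<Sum>h = 1..horizon ?P. reward ?P h (fst (\<tau> ! (h - 1)))) = 2 * indicator ?X \<tau>"
    if \<tau>: "\<tau> \<in> set_pmf (episode ?P \<pi>)" for \<tau>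
  proof -
    note len = set_pmf_episode_lock(1)[OF \<tau>]
    \<comment> \<open>List index \<open>i\<close> belongs to step \<open>i + 1\<close>, so these are
      the two rewarded steps; by then all \<open>m + 1\<close> digits have been entered.\<close>
    have *: "fst (\<tau> ! i) = of_bool (\<tau> \<in> ?X)" if "i \<in> {m + 1, m + 2}" for i
      using that len w set_pmf_episode_lock(2)[OF \<tau>, of i]
      by (auto simp: lock_obs_def lock_state_password take_map min_def)
    have "{1..m + 3} = {1..m + 1} \<union> {m + 2, m + 3}" by auto
    then have "(\<Sum>h = 1..horizon ?P. reward ?P h (fst (\<tau> ! (h - 1)))) =
        (\<Sum>h\<in>{m + 2, m + 3}. reward ?P h (fst (\<tau> ! (h - 1))))"
      by (intro sum.mono_neutral_right) auto
    also have "\<dots> = 2 * indicator ?X \<tau>"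
      using *[of "m + 1"] *[of "m + 2"] by (auto simp: indicator_def)
    finally show ?thesis .
  qed
  have "policy_value ?P \<pi> = measure_pmf.expectation (episode ?P \<pi>) (\<lambda>\<tau>. 2 * indicator ?X \<tau>)"
    unfolding policy_value_def by (intro integral_cong_AE AE_pmfI sum) simp_all
  also have "\<dots> = 2 * measure_pmf.prob (episode ?P \<pi>) ?X" by simp
  also have "measure_pmf.prob (episode ?P \<pi>) ?X =
      measure_pmf.prob (episode (lock A m (\<lambda>_ _. True)) \<pi>) ?X"
  proof (intro measure_pmf_cong_on pmf_episode_lock_cong allI impI)
    fix \<tau> i assume "\<tau> \<in> ?X" "i < length \<tau>"
    then have "w ! j = snd (\<tau> ! j)" if "j < i" "j < m + 1" for j
      using that by auto
    then have "password w (Suc j) (snd (\<tau> ! j))" if "j < i" for j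
      using that w by (cases "j < m + 1") (auto simp: password_def)
    then show "lock_obs m (password w) (take i \<tau>) = lock_obs m (\<lambda>_ _. True) (take i \<tau>)"
      using \<open>i < length \<tau>\<close> by (simp add: lock_obs_def lock_state_def)
  qed
  finally show ?thesis .
qed

lemma optimal_value_lock:
  assumes w: "length w = m + 1" "set w \<subseteq> {..<A}" and "1 \<le> A"
  shows "optimal_value (lock A m (password w)) \<ge> 2"
proof -
  let ?P = "lock A m (password w)"
  \<comment> \<open>The digits in order; action 0 afterwards is admissible because \<open>A\<close>
    is positive.\<close>
  define \<pi> :: policy where "\<pi> h \<tau> ob = return_pmf (if h \<le> m + 1 then w ! (h - 1) else 0)" for h \<tau> ob
  have "\<pi> \<in> policies A 2 (m + 3)"
    using assms by (auto simp: policies_def \<pi>_def subset_iff)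
  moreover have "bdd_above (policy_value ?P ` policies A 2 (m + 3))"
    by (rule bdd_aboveI2[where M = 2]) (simp add: policy_value_lock w)
  moreover have "policy_value ?P \<pi> = 2"
  proof -
    have "take (m + 1) (map snd \<tau>) = w" if "\<tau> \<in> set_pmf (episode (lock A m (\<lambda>_ _. True)) \<pi>)" for \<tau>
      using set_pmf_episode_lock(1,3)[OF that] w
      by (auto simp: list_eq_iff_nth_eq \<pi>_def)
    then show ?thesis
      by (simp add: policy_value_lock w measure_pmf.prob_eq_1 AE_measure_pmf_iff)
  qed
  ultimately show ?thesis
    unfolding optimal_value_def by (simp add: cSUP_upper2)
qed

text \<open>Both opening probabilities are taken under the same law, that of the lock accepting
  everything, and the two events are disjoint. The threshold is
  \<open>(2 - 1/2) / 2 = 3/4\<close>.\<close>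

lemma eps_optimal_lock_unique:
  assumes "eps_optimal (lock A m (password v)) (1/2) \<pi>" "eps_optimal (lock A m (password w)) (1/2) \<pi>"
    and v: "length v = m + 1" "set v \<subseteq> {..<A}" and w: "length w = m + 1" "set w \<subseteq> {..<A}"
    and "1 \<le> A"
  shows "v = w"
proof (rule ccontr)
  assume "v \<noteq> w"
  let ?p = "episode (lock A m (\<lambda>_ _. True)) \<pi>"
  let ?X = "\<lambda>w. {\<tau> :: history. take (m + 1) (map snd \<tau>) = w}"
  have "measure_pmf.prob ?p (?X v) \<ge> 3/4" "measure_pmf.prob ?p (?X w) \<ge> 3/4"
    using assms(1,2) optimal_value_lock[OF v \<open>1 \<le> A\<close>] optimal_value_lock[OF w \<open>1 \<le> A\<close>]
    by (auto simp: eps_optimal_def policy_value_lock v w)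
  moreover have "measure_pmf.prob ?p (?X v \<union> ?X w) =
      measure_pmf.prob ?p (?X v) + measure_pmf.prob ?p (?X w)"
    by (rule measure_pmf.finite_measure_Union) (use \<open>v \<noteq> w\<close> in auto)
  ultimately show False
    using measure_pmf.prob_le_1[of ?p "?X v \<union> ?X w"] by simp
qed

section \<open>Learning a password\<close>

definition passwords :: "nat \<Rightarrow> nat \<Rightarrow> nat list set" where
  "passwords A m = {w. set w \<subseteq> {..<A} \<and> length w = m + 1}"

text \<open>Only \<open>m\<close> digits are compared, since step \<open>m + 1\<close> already
  reveals whether they were right. Recorded entries are observation, action, reward, so
  \<open>fst \<circ> snd\<close> is the action.\<close>

definition tried :: "nat \<Rightarrow> nat list \<Rightarrow> data set" where
  "tried m w = {D. \<exists>e\<in>set D. take m (map (fst \<circ> snd) e) = take m w}"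

lemma finite_passwords: "finite (passwords A m)"
  unfolding passwords_def by (rule finite_lists_length_eq) simp

lemma card_passwords: "card (passwords A m) = A ^ (m + 1)"
  unfolding passwords_def by (subst card_lists_length_eq) auto

lemma actions_recorded: "map (fst \<circ> snd) (recorded P \<tau>) = map snd \<tau>"
  by (rule nth_equalityI) (simp_all add: recorded_def)

lemma recorded_lock: "recorded (lock A m ok) \<tau> = recorded (lock A m ok') \<tau>"
  by (simp add: recorded_def)

lemma length_interact: "D \<in> set_pmf (interact P f k) \<Longrightarrow> length D = k"
  by (induction k arbitrary: D) auto

text \<open>Both locks show 1 at step 1 and 0 up to step \<open>m\<close>. From then on the null
  lock has failed at its first action and the other at a wrong digit.\<close>

lemma lock_obs_password_eq_null:
  assumes "1 \<le> m" "m \<le> length w" "take m (map snd \<tau>) \<noteq> take m w" "i < length \<tau>"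
  shows "lock_obs m (password w) (take i \<tau>) = lock_obs m (\<lambda>_ _. False) (take i \<tau>)"
proof (cases "m \<le> i")
  case True
  have "\<not> (\<forall>j<i. password w (Suc j) (snd (\<tau> ! j)))"
  proof
    assume *: "\<forall>j<i. password w (Suc j) (snd (\<tau> ! j))"
    have "snd (\<tau> ! j) = w ! j" if "j < m" for j
      using *[rule_format, of j] that True assms(2) by (auto simp: password_def)
    then have "take m (map snd \<tau>) = take m w"
      using assms True by (auto simp: list_eq_iff_nth_eq)
    then show False using assms by simp
  qed
  then show ?thesis using True assms by (auto simp: lock_obs_def lock_state_def)
next
  case False
  then show ?thesis using assms by (auto simp: lock_obs_def)
qed

text \<open>Policies depend on earlier data only, so the likelihood of the data factorises over
  episodes, none of which enters the first \<open>m\<close> digits.\<close>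

lemma pmf_interact_eq_null:
  assumes "1 \<le> m" "m \<le> length w" "D \<notin> tried m w"
  shows "pmf (interact (lock A m (password w)) f k) D =
    pmf (interact (lock A m (\<lambda>_ _. False)) f k) D"
  using assms(3)
proof (induction k arbitrary: D)
  case 0
  then show ?case by simp
next
  case (Suc k)
  show ?case
  proof (cases D rule: rev_cases)
    case Nil
    then have "D \<notin> set_pmf (interact P f (Suc k))" for P
      using length_interact[of D P f "Suc k"] by auto
    then show ?thesis by (metis pmf_eq_0_set_pmf)
  next
    case (snoc D' x)
    let ?F = "\<lambda>\<tau>. D' @ [recorded (lock A m (\<lambda>_ _. False)) \<tau>]"
    have step: "pmf (interact (lock A m ok) f (Suc k)) D =
        measure_pmf.prob (episode (lock A m ok) (f D')) (?F -` {D}) * pmf (interact (lock A m ok) f k) D'"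
      for ok
    proof -
      \<comment> \<open>Each episode appends one record, so \<open>D'\<close> is the only earlier
        data that can lead to \<open>D\<close>.\<close>
      have "pmf (interact (lock A m ok) f (Suc k)) D =
          (\<Sum>E\<in>{D'}. pmf (map_pmf (\<lambda>\<tau>. E @ [recorded (lock A m ok) \<tau>])
            (episode (lock A m ok) (f E))) D * pmf (interact (lock A m ok) f k) E)"
        unfolding interact.simps pmf_bind
        by (rule integral_measure_pmf_real) (auto simp: snoc pmf_eq_0_set_pmf)
      then show ?thesis
        by (simp add: pmf_map recorded_lock[of A m ok _ "\<lambda>_ _. False"])
    qed
    have "measure_pmf.prob (episode (lock A m (password w)) (f D')) (?F -` {D}) =
        measure_pmf.prob (episode (lock A m (\<lambda>_ _. False)) (f D')) (?F -` {D})"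
    proof (intro measure_pmf_cong_on pmf_episode_lock_cong allI impI)
      fix \<tau> i assume \<tau>: "\<tau> \<in> ?F -` {D}" "i < length \<tau>"
      then have "x = recorded (lock A m (\<lambda>_ _. False)) \<tau>" using snoc by simp
      then have "take m (map snd \<tau>) \<noteq> take m w"
        using Suc.prems snoc by (auto simp: tried_def actions_recorded)
      then show "lock_obs m (password w) (take i \<tau>) = lock_obs m (\<lambda>_ _. False) (take i \<tau>)"
        using assms \<tau> by (intro lock_obs_password_eq_null)
    qed
    moreover have "D' \<notin> tried m w" using Suc.prems snoc by (auto simp: tried_def)
    ultimately show ?thesis unfolding step using Suc.IH by simp
  qed
qed

text \<open>The two laws agree off \<open>tried m w\<close>, hence by complements also on the
  probability of \<open>tried m w\<close> itself.\<close>

lemma prob_interact_le_null: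
  fixes A k :: nat and f :: "data \<Rightarrow> policy"
  assumes "1 \<le> m" "m \<le> length w"
  defines "p \<equiv> \<lambda>ok. measure_pmf.prob (interact (lock A m ok) f k)"
  shows "p (password w) E \<le> p (\<lambda>_ _. False) E + p (\<lambda>_ _. False) (tried m w)"
proof -
  have eq: "p (password w) X = p (\<lambda>_ _. False) X" if "X \<inter> tried m w = {}" for X
    unfolding p_def using that assms by (intro measure_pmf_cong_on pmf_interact_eq_null) auto
  have compl: "p ok X = 1 - p ok (- X)" for ok X
    using measure_pmf.prob_compl[of X "interact (lock A m ok) f k"]
    by (simp add: p_def Compl_eq_Diff_UNIV)
  have "p (password w) E \<le> p (password w) ((E - tried m w) \<union> tried m w)"
    unfolding p_def by (intro measure_pmf.finite_measure_mono) auto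
  also have "\<dots> \<le> p (password w) (E - tried m w) + p (password w) (tried m w)"
    unfolding p_def by (intro measure_subadditive) auto
  also have "p (password w) (tried m w) = p (\<lambda>_ _. False) (tried m w)"
    using eq[of "- tried m w"] by (simp add: compl[of _ "tried m w"])
  also have "p (password w) (E - tried m w) = p (\<lambda>_ _. False) (E - tried m w)"
    by (rule eq) auto
  also have "\<dots> \<le> p (\<lambda>_ _. False) E"
    unfolding p_def by (intro measure_pmf.finite_measure_mono) auto
  finally show ?thesis by simp
qed

text \<open>An episode determines the first \<open>m\<close> digits and leaves \<open>A\<close>
  choices for the last.\<close>

lemma card_tried_le: "card {w \<in> passwords A m. D \<in> tried m w} \<le> length D * A"
proof -
  let ?ext = "\<lambda>e. (\<lambda>a. take m (map (fst \<circ> snd) e) @ [a]) ` {..<A}"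
  have "{w \<in> passwords A m. D \<in> tried m w} \<subseteq> (\<Union>e\<in>set D. ?ext e)"
  proof
    fix w assume "w \<in> {w \<in> passwords A m. D \<in> tried m w}"
    then obtain e where e: "e \<in> set D" "take m (map (fst \<circ> snd) e) = take m w"
      and w: "set w \<subseteq> {..<A}" "length w = m + 1"
      by (auto simp: passwords_def tried_def)
    have "w = take m w @ [w ! m]"
      using w take_Suc_conv_app_nth[of m w] by simp
    moreover have "w ! m < A" using w by (auto simp: subset_iff)
    ultimately show "w \<in> (\<Union>e\<in>set D. ?ext e)" using e by force
  qed
  then have "card {w \<in> passwords A m. D \<in> tried m w} \<le> card (\<Union>e\<in>set D. ?ext e)"
    by (intro card_mono) auto
  also have "\<dots> \<le> (\<Sum>e\<in>set D. card (?ext e))" by (rule card_UN_le) simp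
  also have "\<dots> \<le> (\<Sum>e\<in>set D. A)"
    by (intro sum_mono) (metis card_image_le card_lessThan finite_lessThan)
  also have "\<dots> \<le> length D * A" by (simp add: card_length)
  finally show ?thesis .
qed

text \<open>Under the null law the success events are disjoint, so they contribute at most 1. The
  hit probabilities add up to the expected number of passwords hit, which is at most
  \<open>k * A\<close>.\<close>

lemma sum_success_le:
  assumes "1 \<le> m" "1 \<le> A"
  shows "(\<Sum>w\<in>passwords A m. measure_pmf.prob (interact (lock A m (password w)) f k)
      {D. eps_optimal (lock A m (password w)) (1/2) (g D)}) \<le> 1 + real (k * A)"
proof -
  let ?q = "interact (lock A m (\<lambda>_ _. False)) f k"
  let ?E = "\<lambda>w. {D. eps_optimal (lock A m (password w)) (1/2) (g D)}"
  have "disjoint_family_on ?E (passwords A m)"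
    using eps_optimal_lock_unique[OF _ _ _ _ _ _ \<open>1 \<le> A\<close>]
    by (fastforce simp: disjoint_family_on_def passwords_def)
  then have "(\<Sum>w\<in>passwords A m. measure_pmf.prob ?q (?E w)) =
      measure_pmf.prob ?q (\<Union>w\<in>passwords A m. ?E w)"
    by (intro measure_pmf.finite_measure_finite_Union[symmetric] finite_passwords) auto
  then have 1: "(\<Sum>w\<in>passwords A m. measure_pmf.prob ?q (?E w)) \<le> 1" by simp
  have int: "integrable (measure_pmf ?q) (indicator (tried m w) :: _ \<Rightarrow> real)" for w
    by (rule integrable_real_indicator) (simp_all add: measure_pmf.emeasure_finite less_top[symmetric])
  have "(\<Sum>w\<in>passwords A m. measure_pmf.prob ?q (tried m w)) =
      measure_pmf.expectation ?q (\<lambda>D. \<Sum>w\<in>passwords A m. indicator (tried m w) D)"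
    by (subst Bochner_Integration.integral_sum) (auto intro: int)
  also have "\<dots> \<le> real (k * A)"
  proof (intro measure_pmf.integral_le_const AE_pmfI)
    fix D assume "D \<in> set_pmf ?q"
    then have "length D = k" by (rule length_interact)
    have "(\<Sum>w\<in>passwords A m. indicator (tried m w) D) =
        real (card {w \<in> passwords A m. D \<in> tried m w})"
      using finite_passwords by (simp add: indicator_def sum.If_cases Int_def)
    then show "(\<Sum>w\<in>passwords A m. indicator (tried m w) D) \<le> real (k * A)"
      using card_tried_le[of A m D] \<open>length D = k\<close> by (simp only: of_nat_le_iff)
  qed (intro Bochner_Integration.integrable_sum int)
  finally have 2: "(\<Sum>w\<in>passwords A m. measure_pmf.prob ?q (tried m w)) \<le> real (k * A)" .
  have "(\<Sum>w\<in>passwords A m. measure_pmf.prob (interact (lock A m (password w)) f k) (?E w)) \<le>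
      (\<Sum>w\<in>passwords A m. measure_pmf.prob ?q (?E w) + measure_pmf.prob ?q (tried m w))"
    by (intro sum_mono prob_interact_le_null) (use assms in \<open>auto simp: passwords_def\<close>)
  then show ?thesis using 1 2 by (simp add: sum.distrib)
qed

text \<open>\<open>sum_success_le\<close> applies for each fixed seed; integrating over the seed
  keeps the bound.\<close>

lemma num_episodes_ge:
  assumes "1 \<le> m" "1 \<le> A" and seed: "prob_space (seed alg)"
    and success: "\<And>w. w \<in> passwords A m \<Longrightarrow> success_prob (lock A m (password w)) (1/2) alg \<ge> 1/2"
  shows "real A ^ (m + 1) / 2 \<le> 1 + real (num_episodes alg * A)"
proof -
  interpret prob_space "seed alg" by (rule seed)
  define G where "G w \<omega> = measure_pmf.prob
      (interact (lock A m (password w)) (explore alg \<omega>) (num_episodes alg))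
      {D. eps_optimal (lock A m (password w)) (1/2) (final alg \<omega> D)}" for w \<omega>
  have G: "(\<integral>\<omega>. G w \<omega> \<partial>seed alg) \<ge> 1/2" if "w \<in> passwords A m" for w
    using success[OF that] by (simp add: success_prob_def G_def)
  text \<open>A non-integrable function would have integral 0.\<close>
  then have int: "integrable (seed alg) (G w)" if "w \<in> passwords A m" for w
    using that not_integrable_integral_eq[of "seed alg" "G w"] by fastforce
  have "real A ^ (m + 1) / 2 = (\<Sum>w\<in>passwords A m. 1/2)" by (simp add: card_passwords)
  also have "\<dots> \<le> (\<Sum>w\<in>passwords A m. \<integral>\<omega>. G w \<omega> \<partial>seed alg)" by (intro sum_mono G)
  also have "\<dots> = (\<integral>\<omega>. (\<Sum>w\<in>passwords A m. G w \<omega>) \<partial>seed alg)"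
    by (subst Bochner_Integration.integral_sum) (auto intro: int)
  also have "\<dots> \<le> 1 + real (num_episodes alg * A)"
    by (intro integral_le_const Bochner_Integration.integrable_sum int AE_I2)
      (simp_all only: G_def sum_success_le[OF assms(1,2)])
  finally show ?thesis .
qed

theorem theorem9:
  shows "\<exists>(c::real) > 0. \<exists>C::nat. \<forall>m A :: nat. 1 \<le> m \<longrightarrow> 1 \<le> A \<longrightarrow>
    (\<exists>S H nO :: nat. S \<le> C * m \<and> H \<le> C * m \<and> nO \<le> C * m \<and>
      (\<exists>hard :: pomdp set. hard \<noteq> {} \<and>
        (\<forall>P\<in>hard. valid_pomdp P \<and> num_states P = S \<and> num_actions P = A \<and> num_obs P = nO \<and>
            horizon P = H \<and> (\<exists>\<alpha>\<ge>1. weakly_revealing m \<alpha> P)) \<and>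
        (\<forall>alg. valid_algorithm A nO H alg \<longrightarrow>
            2 \<le> A \<or> 1 \<le> num_episodes alg \<longrightarrow>
            (\<forall>P\<in>hard. success_prob P (1/2) alg \<ge> 1/2) \<longrightarrow>
            real (num_episodes alg) \<ge> c * real A ^ (m - 1))))"
\<comment> \<open>The factor 4 covers the horizon \<open>m + 3\<close>, as \<open>m\<close> is at
  least 1.\<close>
proof (rule exI[of _ "1/4"], rule conjI, simp, rule exI[of _ 4], intro allI impI)
  fix m A :: nat assume m: "1 \<le> m" and A: "1 \<le> A"
  let ?hard = "(\<lambda>w. lock A m (password w)) ` passwords A m"
  have "replicate (m + 1) 0 \<in> passwords A m" using A by (auto simp: passwords_def)
  then have ne: "?hard \<noteq> {}" by blast
  have revealing: "\<forall>P\<in>?hard. valid_pomdp P \<and> num_states P = 2 \<and> num_actions P = A \<and>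
      num_obs P = 2 \<and> horizon P = m + 3 \<and> (\<exists>\<alpha>\<ge>1. weakly_revealing m \<alpha> P)"
  proof
    fix P assume "P \<in> ?hard"
    then obtain w where P: "P = lock A m (password w)" and w: "w \<in> passwords A m" by blast
    have "\<exists>a<A. password w h a" for h
    proof (cases "length w < h")
      case True
      then show ?thesis using A by (auto simp: password_def intro!: exI[of _ 0])
    next
      case False
      then have "w ! (h - 1) \<in> set w" using w by (auto simp: passwords_def)
      then show ?thesis
        using w by (auto simp: password_def passwords_def)
    qed
    then have "weakly_revealing m 1 P" unfolding P by (rule weakly_revealing_lock[OF m])
    then show "valid_pomdp P \<and> num_states P = 2 \<and> num_actions P = A \<and>
      num_obs P = 2 \<and> horizon P = m + 3 \<and> (\<exists>\<alpha>\<ge>1. weakly_revealing m \<alpha> P)"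
      by (auto simp: P valid_lock)
  qed
  have bound: "real (num_episodes alg) \<ge> 1/4 * real A ^ (m - 1)"
    if alg: "valid_algorithm A 2 (m + 3) alg" "2 \<le> A \<or> 1 \<le> num_episodes alg"
      "\<forall>P\<in>?hard. success_prob P (1/2) alg \<ge> 1/2" for alg
  proof (cases "2 \<le> A")
    case True
    have "real A ^ (m + 1) / 2 \<le> 1 + real (num_episodes alg * A)"
      using alg by (intro num_episodes_ge[OF m A]) (auto simp: valid_algorithm_def)
    \<comment> \<open>This absorbs the summand 1 into half of the left-hand side, which gives the
      constant 1/4.\<close>
    moreover have "real A ^ (m + 1) \<ge> 4"
    proof -
      have "(4::real) = 2 ^ 2" by simp
      also have "\<dots> \<le> real A ^ 2" using True by (intro power_mono) auto
      also have "\<dots> \<le> real A ^ (m + 1)" using m A by (intro power_increasing) auto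
      finally show ?thesis .
    qed
    ultimately have "real A ^ m * real A \<le> (4 * real (num_episodes alg)) * real A"
      by (simp add: mult.commute mult.left_commute)
    then have "real A ^ m \<le> 4 * real (num_episodes alg)" using A by simp
    moreover have "real A ^ (m - 1) \<le> real A ^ m" using A by (intro power_increasing) auto
    ultimately show ?thesis by simp
  next
    case False
    then have "A = 1" using A by simp
    then show ?thesis using alg(2) by simp
  qed
  show "\<exists>S H nO :: nat. S \<le> 4 * m \<and> H \<le> 4 * m \<and> nO \<le> 4 * m \<and>
      (\<exists>hard :: pomdp set. hard \<noteq> {} \<and>
        (\<forall>P\<in>hard. valid_pomdp P \<and> num_states P = S \<and> num_actions P = A \<and> num_obs P = nO \<and>
            horizon P = H \<and> (\<exists>\<alpha>\<ge>1. weakly_revealing m \<alpha> P)) \<and>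
        (\<forall>alg. valid_algorithm A nO H alg \<longrightarrow>
            2 \<le> A \<or> 1 \<le> num_episodes alg \<longrightarrow>
            (\<forall>P\<in>hard. success_prob P (1/2) alg \<ge> 1/2) \<longrightarrow>
            real (num_episodes alg) \<ge> 1/4 * real A ^ (m - 1)))"
    by (rule exI[of _ 2], rule exI[of _ "m + 3"], rule exI[of _ 2], intro conjI exI[of _ ?hard] ne revealing)
      (use m bound in auto)
qed

end
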